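(* Let $V$ be a probability mass function whose support is the whole of $\mathbb{Z}_+=\{0,1,2,\dots\}$. For any functions $f$ and $g$, $$\sum_{x=0}^\infty V(x)\Gamma^{(V)}_1(f,g)(x)=\sum_{x=0}^\infty V(x)\,(f(x+1)-f(x))(g(x+1)-g(x)),$$ $$\sum_{x=0}^\infty V(x)\Gamma^{(V)}_2(f,g)(x)=\sum_{x=0}^\infty V(x)\,Lf(x+1)\,Lg(x+1)+\sum_{x=0}^\infty V(x)\,\mathcal{E}^{(V)}(x)\,(f(x+1)-f(x))(g(x+1)-g(x)).$$ Hence, if $V$ is $c$-log-concave, i.e. $\mathcal{E}^{(V)}(x)\ge c$ for all $x\in\mathbb{Z}_+$, then the integrated BE($c$) condition holds: for all functions $f$, $$\sum_{x=0}^\infty V(x)\Gamma^{(V)}_2(f,f)(x)\ge c\sum_{x=0}^\infty V(x)\Gamma^{(V)}_1(f,f)(x).$$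
   Context: Functions are real-valued functions on $\mathbb{Z}_+$. Convention: $V(-1)=0$ (so terms multiplied by $V(-1)$ are $0$). Definitions: $$Lf(x)=f(x+1)-2f(x)+f(x-1),\qquad \mathcal{E}^{(V)}(x)=\frac{V(x)}{V(x+1)}-\frac{V(x-1)}{V(x)},$$ $$L_Vf(x)=\bigl(f(x+1)-f(x)\bigr)-\frac{V(x-1)}{V(x)}\bigl(f(x)-f(x-1)\bigr),$$ $$\Gamma^{(V)}_1(f,g)=\tfrac12\left[L_V(fg)-fL_Vg-gL_Vf\right],$$ $$\Gamma^{(V)}_2(f,g)=\tfrac12\left[L_V\bigl(\Gamma^{(V)}_1(f,g)\bigr)-\Gamma^{(V)}_1(f,L_Vg)-\Gamma^{(V)}_1(g,L_Vf)\right].$$ *)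

theory Defs
  imports "HOL-Probability.Probability_Mass_Function"
begin

text \<open>
  The operators act on real functions on the non-negative integers.  A value \<open>f (x - 1)\<close> at \<open>x = 0\<close>
  (where natural subtraction gives \<open>f 0\<close>) only ever occurs multiplied by \<open>V(-1) = 0\<close>, or in
  \<open>Lap f 0\<close>, which is not used below.
\<close>

definition Lap :: "(nat \<Rightarrow> real) \<Rightarrow> nat \<Rightarrow> real" where
  "Lap f x = f (x + 1) - 2 * f x + f (x - 1)"

text \<open>\<open>V(x - 1)\<close> with the convention \<open>V(-1) = 0\<close>.\<close>

definition prev :: "(nat \<Rightarrow> real) \<Rightarrow> nat \<Rightarrow> real" where
  "prev V x = (if x = 0 then 0 else V (x - 1))"

definition score :: "(nat \<Rightarrow> real) \<Rightarrow> nat \<Rightarrow> real" where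
  "score V x = V x / V (x + 1) - prev V x / V x"

definition L_op :: "(nat \<Rightarrow> real) \<Rightarrow> (nat \<Rightarrow> real) \<Rightarrow> nat \<Rightarrow> real" where
  "L_op V f x = (f (x + 1) - f x) - prev V x / V x * (f x - f (x - 1))"

definition Gamma1 :: "(nat \<Rightarrow> real) \<Rightarrow> (nat \<Rightarrow> real) \<Rightarrow> (nat \<Rightarrow> real) \<Rightarrow> nat \<Rightarrow> real" where
  "Gamma1 V f g x = 1 / 2 * (L_op V (\<lambda>y. f y * g y) x - f x * L_op V g x - g x * L_op V f x)"

definition Gamma2 :: "(nat \<Rightarrow> real) \<Rightarrow> (nat \<Rightarrow> real) \<Rightarrow> (nat \<Rightarrow> real) \<Rightarrow> nat \<Rightarrow> real" where
  "Gamma2 V f g x =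
     1 / 2 * (L_op V (Gamma1 V f g) x - Gamma1 V f (L_op V g) x - Gamma1 V g (L_op V f) x)"

definition c_log_concave :: "real \<Rightarrow> (nat \<Rightarrow> real) \<Rightarrow> bool" where
  "c_log_concave c V \<longleftrightarrow> (\<forall>x. score V x \<ge> c)"

text \<open>
  The condition ranges over all functions \<open>f\<close>, so both series are taken in the extended reals.
  The terms \<open>V x * Gamma1 V f f x\<close> are non-negative; if \<open>c < 0\<close> and their sum is infinite,
  the bound is \<open>- \<infinity>\<close> and nothing is required of the other series.
\<close>

definition integrated_BE :: "real \<Rightarrow> (nat \<Rightarrow> real) \<Rightarrow> bool" where
  "integrated_BE c V \<longleftrightarrow>
     (\<forall>f :: nat \<Rightarrow> real.
        (\<Sum>x. ereal (V x * Gamma2 V f f x)) \<ge> ereal c * (\<Sum>x. ereal (V x * Gamma1 V f f x)))"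

end

theory Submission
  imports Defs
begin

text \<open>
  Both integral formulas come from exact pointwise identities. Write \<open>prev a\<close> for the sequence \<open>a\<close>
  moved one step to the right with \<open>0\<close> in front, and put
  \<open>a x = V x * \<Delta>f x * \<Delta>g x\<close>, \<open>b x = V x * Lap f (x + 1) * Lap g (x + 1)\<close> and
  \<open>e x = V x * score V x * \<Delta>f x * \<Delta>g x\<close>, where \<open>\<Delta>f x = f (x + 1) - f x\<close>. Since the
  backward rate \<open>V (x - 1) / V x\<close> turns the weight \<open>V x\<close> into \<open>V (x - 1)\<close>,
  \<^item> \<open>V * \<Gamma>\<^sub>1 = a / 2 + prev a / 2\<close>,
  \<^item> \<open>V * \<Gamma>\<^sub>2 = b / 4 + prev b / 2 + prev (prev b) / 4 + 3 e / 4 + prev e / 4\<close>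
    (a discrete Bochner formula).

  The weights on the shifts of \<open>a\<close>, of \<open>b\<close> and of \<open>e\<close> each add up to \<open>1\<close>, and a shift changes neither
  convergence nor the value of a series, even an infinite value. So the series on the left has the
  value of the one on the right (\<open>sums_Gamma1\<close>, \<open>sums_Gamma2\<close>). Summing up to \<open>n\<close> gives weighted means
  of the last partial sums on the right, so that summation by parts leaves no boundary term at
  infinity to be estimated.

  For \<open>f = g\<close> the \<open>b\<close>-series is non-negative, and \<open>score V x \<ge> c\<close> bounds the \<open>e\<close>-series below by
  \<open>c\<close> times the \<open>a\<close>-series, which is the integrated curvature condition. Care is needed only for
  \<open>c < 0\<close>, where the \<open>e\<close>-series need not converge if the \<open>a\<close>-series is infinite; the bound is then
  \<open>- \<infinity>\<close>.
\<close>

section \<open>Pointwise identities\<close>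

definition back_rate :: "(nat \<Rightarrow> real) \<Rightarrow> nat \<Rightarrow> real" where
  "back_rate V x = prev V x / V x"

definition incr :: "(nat \<Rightarrow> real) \<Rightarrow> nat \<Rightarrow> real" where
  "incr f x = f (Suc x) - f x"

lemma back_rate_0 [simp]: "back_rate V 0 = 0"
  by (simp add: back_rate_def prev_def)

lemma prev_0 [simp]: "prev a 0 = 0"
  by (simp add: prev_def)

lemma prev_Suc [simp]: "prev a (Suc x) = a x"
  by (simp add: prev_def)

lemma weight_back_rate:
  assumes "V (Suc x) \<noteq> 0"
  shows "V (Suc x) * back_rate V (Suc x) = V x"
  using assms by (simp add: back_rate_def)

lemma score_eq_back_rate: "score V x = back_rate V (Suc x) - back_rate V x"
  by (simp add: score_def back_rate_def)

lemma Lap_Suc: "Lap f (Suc x) = incr f (Suc x) - incr f x"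
  by (simp add: Lap_def incr_def)

lemma L_op_eq_incr:
  "L_op V f 0 = incr f 0"
  "L_op V f (Suc x) = incr f (Suc x) - back_rate V (Suc x) * incr f x"
  by (simp_all add: L_op_def back_rate_def prev_def incr_def)

text \<open>
  The terms linear in the increments cancel, because \<open>L_op\<close> is a weighted sum of differences; what is
  left is one product of increments for each of the two possible jumps.
\<close>

lemma Gamma1_eq_incr:
  "Gamma1 V f g 0 = 1 / 2 * (incr f 0 * incr g 0)"
  "Gamma1 V f g (Suc x) =
     1 / 2 * (incr f (Suc x) * incr g (Suc x) + back_rate V (Suc x) * (incr f x * incr g x))"
  by (simp_all add: Gamma1_def L_op_eq_incr) (simp_all add: incr_def algebra_simps)

lemma weighted_Gamma1:
  fixes V f g :: "nat \<Rightarrow> real"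
  assumes "\<And>x. V x \<noteq> 0"
  defines "a \<equiv> \<lambda>x. V x * (f (x + 1) - f x) * (g (x + 1) - g x)"
  shows "V x * Gamma1 V f g x = 1 / 2 * a x + 1 / 2 * prev a x"
proof -
  have a: "a x = V x * (incr f x * incr g x)" for x
    by (simp add: a_def incr_def)
  show ?thesis
  proof (cases x)
    case 0
    then show ?thesis by (simp add: Gamma1_eq_incr a)
  next
    case (Suc y)
    then show ?thesis
      using assms(1) by (simp add: Gamma1_eq_incr a weight_back_rate[symmetric, of V y] algebra_simps)
  qed
qed

text \<open>
  For \<open>x \<ge> 2\<close>, divided by \<open>V x\<close>, the Bochner formula is a polynomial identity in the backward rates at \<open>x - 1\<close>,
  \<open>x\<close>, \<open>x + 1\<close> and the increments of \<open>f\<close> and \<open>g\<close> near \<open>x\<close>: the product of two consecutive rates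
  carries the weight at \<open>x\<close> to the weight at \<open>x - 2\<close>, and the score is the difference of two
  consecutive rates. For \<open>x < 2\<close> the same computation runs with some of the shifts equal to \<open>0\<close>.
\<close>

lemma weighted_Gamma2:
  fixes V f g :: "nat \<Rightarrow> real"
  assumes "\<And>x. V x \<noteq> 0"
  defines "b \<equiv> \<lambda>x. V x * Lap f (x + 1) * Lap g (x + 1)"
    and "e \<equiv> \<lambda>x. V x * score V x * (f (x + 1) - f x) * (g (x + 1) - g x)"
  shows "V x * Gamma2 V f g x =
    1 / 4 * b x + 1 / 2 * prev b x + 1 / 4 * prev (prev b) x + 3 / 4 * e x + 1 / 4 * prev e x"
proof -
  have b: "b x = V x * ((incr f (Suc x) - incr f x) * (incr g (Suc x) - incr g x))" for x
    by (simp add: b_def Lap_Suc)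
  have e: "e x = V x * ((back_rate V (Suc x) - back_rate V x) * (incr f x * incr g x))" for x
    by (simp add: e_def incr_def score_eq_back_rate)
  have incr_L_op: "incr (L_op V h) x = L_op V h (Suc x) - L_op V h x" for h x
    by (simp add: incr_def)
  have incr_Gamma1: "incr (Gamma1 V f g) x = Gamma1 V f g (Suc x) - Gamma1 V f g x" for x
    by (simp add: incr_def)
  note expand = Gamma2_def L_op_eq_incr Gamma1_eq_incr incr_L_op incr_Gamma1
  have w: "V x = V (Suc x) * back_rate V (Suc x)" for x
    using weight_back_rate[of V x] assms(1) by simp
  consider "x = 0" | "x = Suc 0" | y where "x = Suc (Suc y)"
    by (metis not0_implies_Suc)
  then show ?thesis
  proof cases
    case 1
    show ?thesis unfolding 1
      by (simp add: b e expand field_simps)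
  next
    case 2
    show ?thesis unfolding 2
      by (simp only: b e expand w[of 0] prev_Suc prev_0 back_rate_0) algebra
  next
    case (3 y)
    show ?thesis unfolding 3
      by (simp only: b e expand w[of y] w[of "Suc y"] prev_Suc) algebra
  qed
qed

section \<open>Shifted series in the extended reals\<close>

lemma sums_prev_ereal:
  assumes "(\<lambda>x. ereal (a x)) sums s"
  shows "(\<lambda>x. ereal (prev a x)) sums s"
proof -
  have "(\<lambda>n. \<Sum>x<Suc n. ereal (prev a x)) = (\<lambda>n. \<Sum>x<n. ereal (a x))"
    by (simp add: sum.lessThan_Suc_shift del: sum.lessThan_Suc)
  with assms have "(\<lambda>n. \<Sum>x<Suc n. ereal (prev a x)) \<longlonglongrightarrow> s"
    by (simp add: sums_def)
  then show ?thesis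
    unfolding sums_def by (rule filterlim_sequentially_Suc[THEN iffD1])
qed

lemma sums_cmult_ereal:
  fixes r :: real
  assumes "(\<lambda>x. ereal (a x)) sums s"
  shows "(\<lambda>x. ereal (r * a x)) sums (ereal r * s)"
proof -
  have "(\<lambda>n. ereal r * (\<Sum>x<n. ereal (a x))) \<longlonglongrightarrow> ereal r * s"
    using assms unfolding sums_def by (intro tendsto_cmult_ereal) auto
  then show ?thesis
    by (simp add: sums_def sum_distrib_left)
qed

lemma sums_add_ereal:
  assumes "(\<lambda>x. ereal (a x)) sums s" "(\<lambda>x. ereal (b x)) sums t"
    and "\<not> (s = \<infinity> \<and> t = - \<infinity>)" "\<not> (s = - \<infinity> \<and> t = \<infinity>)"
  shows "(\<lambda>x. ereal (a x + b x)) sums (s + t)"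
proof -
  have "(\<lambda>n. (\<Sum>x<n. ereal (a x)) + (\<Sum>x<n. ereal (b x))) \<longlonglongrightarrow> s + t"
    using assms unfolding sums_def by (intro tendsto_add_ereal_general) auto
  then show ?thesis
    by (simp add: sums_def sum.distrib)
qed

text \<open>
  Two series with the same value, weighted positively, cannot meet as opposite infinities; so
  replacing a series by a weighted mean of its shifts works for infinite values as well.
\<close>

lemma sums_weighted_add_ereal:
  fixes p q :: real
  assumes a: "(\<lambda>x. ereal (a x)) sums s" and b: "(\<lambda>x. ereal (b x)) sums s"
    and pq: "p > 0" "q > 0"
  shows "(\<lambda>x. ereal (p * a x + q * b x)) sums (ereal (p + q) * s)"
proof -
  have "(\<lambda>x. ereal (p * a x + q * b x)) sums (ereal p * s + ereal q * s)"
    using pq by (intro sums_add_ereal sums_cmult_ereal a b; cases s) auto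
  moreover have "ereal p * s + ereal q * s = ereal (p + q) * s"
    using pq by (cases s) (auto simp: algebra_simps)
  ultimately show ?thesis by simp
qed

section \<open>The integral formulas\<close>

lemma sums_Gamma1:
  assumes "\<And>x. V x \<noteq> 0"
    and "(\<lambda>x. ereal (V x * (f (x + 1) - f x) * (g (x + 1) - g x))) sums s"
  shows "(\<lambda>x. ereal (V x * Gamma1 V f g x)) sums s"
  using sums_weighted_add_ereal[OF assms(2) sums_prev_ereal[OF assms(2)], of "1 / 2" "1 / 2"]
  by (simp add: weighted_Gamma1[where V = V and f = f and g = g, OF assms(1)] one_ereal_def[symmetric])

lemma sums_Gamma2:
  assumes V: "\<And>x. V x \<noteq> 0"
    and b: "(\<lambda>x. ereal (V x * Lap f (x + 1) * Lap g (x + 1))) sums s" (is "(\<lambda>x. ereal (?b x)) sums s")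
    and e: "(\<lambda>x. ereal (V x * score V x * (f (x + 1) - f x) * (g (x + 1) - g x))) sums t"
      (is "(\<lambda>x. ereal (?e x)) sums t")
    and st: "\<not> (s = \<infinity> \<and> t = - \<infinity>)" "\<not> (s = - \<infinity> \<and> t = \<infinity>)"
  shows "(\<lambda>x. ereal (V x * Gamma2 V f g x)) sums (s + t)"
proof -
  have b1: "(\<lambda>x. ereal (prev ?b x)) sums s" and b2: "(\<lambda>x. ereal (prev (prev ?b) x)) sums s"
    using b by (intro sums_prev_ereal; assumption)+
  have *: "(\<lambda>x. ereal (1 / 2 * ?b x + 1 / 2 * prev ?b x)) sums s"
    and **: "(\<lambda>x. ereal (1 / 2 * prev ?b x + 1 / 2 * prev (prev ?b) x)) sums s"
    using sums_weighted_add_ereal[OF b b1, of "1 / 2" "1 / 2"]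
      sums_weighted_add_ereal[OF b1 b2, of "1 / 2" "1 / 2"]
    by (simp_all add: one_ereal_def[symmetric])
  \<comment> \<open>The weights \<open>1/4, 1/2, 1/4\<close> are those of averaging two neighbours twice.\<close>
  have B: "(\<lambda>x. ereal (1 / 2 * (1 / 2 * ?b x + 1 / 2 * prev ?b x)
      + 1 / 2 * (1 / 2 * prev ?b x + 1 / 2 * prev (prev ?b) x))) sums s"
    using sums_weighted_add_ereal[OF * **, of "1 / 2" "1 / 2"]
    by (simp add: one_ereal_def[symmetric])
  have E: "(\<lambda>x. ereal (3 / 4 * ?e x + 1 / 4 * prev ?e x)) sums t"
    using sums_weighted_add_ereal[OF e sums_prev_ereal[OF e], of "3 / 4" "1 / 4"]
    by (simp add: one_ereal_def[symmetric])
  have regroup: "1 / 4 * u + 1 / 2 * v + 1 / 4 * w + 3 / 4 * y + 1 / 4 * z =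
      (1 / 2 * (1 / 2 * u + 1 / 2 * v) + 1 / 2 * (1 / 2 * v + 1 / 2 * w)) + (3 / 4 * y + 1 / 4 * z)"
    for u v w y z :: real
    by (simp add: field_simps)
  show ?thesis
    unfolding weighted_Gamma2[where V = V and f = f and g = g, OF V] regroup
    by (rule sums_add_ereal[OF B E st])
qed

section \<open>The integrated curvature condition\<close>

text \<open>
  Lowering the score to \<open>c\<close> turns the \<open>e\<close>-series into \<open>c\<close> times the \<open>a\<close>-series, which is the value of
  the \<open>\<Gamma>\<^sub>1\<close>-series; the \<open>b\<close>-series, a sum of squares, can be dropped.
\<close>

lemma integrated_BE_if_c_log_concave:
  assumes V: "\<And>x. V x > 0" and c: "c_log_concave c V"
  shows "integrated_BE c V"
  unfolding integrated_BE_def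
proof
  fix f :: "nat \<Rightarrow> real"
  let ?a = "\<lambda>x. V x * (f (x + 1) - f x) * (f (x + 1) - f x)"
  let ?b = "\<lambda>x. V x * Lap f (x + 1) * Lap f (x + 1)"
  let ?e = "\<lambda>x. V x * score V x * (f (x + 1) - f x) * (f (x + 1) - f x)"
  define A where "A = (\<Sum>x. ereal (?a x))"
  define B where "B = (\<Sum>x. ereal (?b x))"
  define U where "U = (\<Sum>x. ereal (?e x - c * ?a x))"
  have V0: "V x \<noteq> 0" for x using V[of x] by simp
  have nonneg_sums: "(\<lambda>x. ereal (h x)) sums (\<Sum>x. ereal (h x))" "0 \<le> (\<Sum>x. ereal (h x))"
    if "\<And>x. h x \<ge> 0" for h :: "nat \<Rightarrow> real"
    using that by (auto intro!: summable_sums summable_ereal_pos suminf_nonneg)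
  have a: "(\<lambda>x. ereal (?a x)) sums A" "A \<ge> 0"
    unfolding A_def using V by (intro nonneg_sums; simp add: mult.assoc less_imp_le)+
  have b: "(\<lambda>x. ereal (?b x)) sums B" "B \<ge> 0"
    unfolding B_def using V by (intro nonneg_sums; simp add: mult.assoc less_imp_le)+
  have "?e x - c * ?a x = (score V x - c) * ?a x" for x
    by (simp add: algebra_simps)
  moreover have "score V x - c \<ge> 0" for x
    using c by (simp add: c_log_concave_def)
  ultimately have "?e x - c * ?a x \<ge> 0" for x
    using V[of x] by (simp add: mult.assoc less_imp_le)
  then have u: "(\<lambda>x. ereal (?e x - c * ?a x)) sums U" "U \<ge> 0"
    unfolding U_def by (intro nonneg_sums; simp)+
  have Gamma1: "(\<Sum>x. ereal (V x * Gamma1 V f f x)) = A"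
    using sums_Gamma1[OF V0 a(1)] by (simp add: sums_iff)
  show "(\<Sum>x. ereal (V x * Gamma2 V f f x)) \<ge> ereal c * (\<Sum>x. ereal (V x * Gamma1 V f f x))"
  proof (cases "ereal c * A = - \<infinity>")
    case True
    show ?thesis unfolding Gamma1 True by simp
  next
    case cA: False
    \<comment> \<open>The terms \<open>e - c * a\<close> are non-negative, so their series always has a value, and adding
      \<open>c * A\<close> back gives one to the \<open>e\<close>-series.\<close>
    have "(\<lambda>x. ereal ((?e x - c * ?a x) + c * ?a x)) sums (U + ereal c * A)"
      using u cA by (intro sums_add_ereal sums_cmult_ereal a) auto
    then have e: "(\<lambda>x. ereal (?e x)) sums (U + ereal c * A)"
      by simp
    have "U + ereal c * A \<noteq> - \<infinity>"
      using u(2) cA by auto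
    then have "(\<lambda>x. ereal (V x * Gamma2 V f f x)) sums (B + (U + ereal c * A))"
      using b(2) by (intro sums_Gamma2[OF V0 b(1) e]) auto
    moreover have "ereal c * A \<le> B + (U + ereal c * A)"
      using add_mono[OF b(2) add_mono[OF u(2) order_refl, of "ereal c * A"]] by simp
    ultimately show ?thesis by (simp add: Gamma1 sums_iff)
  qed
qed

theorem proposition4p2:
  fixes V :: "nat pmf"
  assumes "set_pmf V = UNIV"
  shows "(\<forall>(f :: nat \<Rightarrow> real) (g :: nat \<Rightarrow> real) (s :: ereal).
            (\<lambda>x. ereal (pmf V x * (f (x + 1) - f x) * (g (x + 1) - g x))) sums s
            \<longrightarrow> (\<lambda>x. ereal (pmf V x * Gamma1 (pmf V) f g x)) sums s)
       \<and> (\<forall>(f :: nat \<Rightarrow> real) (g :: nat \<Rightarrow> real) (s :: ereal) (t :: ereal).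
            (\<lambda>x. ereal (pmf V x * Lap f (x + 1) * Lap g (x + 1))) sums s
            \<longrightarrow> (\<lambda>x. ereal (pmf V x * score (pmf V) x * (f (x + 1) - f x) * (g (x + 1) - g x))) sums t
            \<longrightarrow> \<not> (s = \<infinity> \<and> t = - \<infinity>) \<and> \<not> (s = - \<infinity> \<and> t = \<infinity>)
            \<longrightarrow> (\<lambda>x. ereal (pmf V x * Gamma2 (pmf V) f g x)) sums (s + t))
       \<and> (\<forall>c :: real. c_log_concave c (pmf V) \<longrightarrow> integrated_BE c (pmf V))"
proof -
  have pos: "pmf V x > 0" for x
    using assms by (simp add: pmf_positive_iff)
  then have nz: "pmf V x \<noteq> 0" for x
    by (metis less_irrefl)
  show ?thesis
    by (intro conjI allI impI sums_Gamma1 sums_Gamma2 integrated_BE_if_c_log_concave pos nz) auto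
qed

end
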